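(* Let $q$ be an odd prime power, $t\ge3$, and $s$ an integer with $1\le s\le2t-1$ and $\gcd(s,2t)=1$. If $m\in\mathscr{P}^-_s$ and $h\in\mathbb{F}_{q^t}$ with $\mathrm{N}_{q^{2t}/q^t}(h)=\pm1$, then $$\psi_{m,h,s}= m\left(X^{q^s}-h^{1-q^{s(t+1)}}X^{q^{s(t+1)}}\right)+X^{q^{s(t-1)}}+h^{1-q^{s(2t-1)}}X^{q^{s(2t-1)}}$$ is not scattered.
   Context: Trace and norm: $\mathrm{Tr}_{q^{2t}/q^t}(x)=x+x^{q^t}$, $\mathrm{N}_{q^{2t}/q^t}(x)=x^{q^t+1}$ for $x\in\mathbb{F}_{q^{2t}}$. $\mathscr{P}^-_s=\{w^{q^s-1}: w\in\ker\mathrm{Tr}_{q^{2t}/q^t}\}\subseteq\mathbb{F}_{q^t}$. $\psi_{m,h,s}$ is viewed as an $\mathbb{F}_q$-linear map of $\mathbb{F}_{q^{2t}}$. A linearized polynomial $f$ over $\mathbb{F}_{q^{2t}}$ is scattered if for all $y,z\in\mathbb{F}_{q^{2t}}^*$ with $f(y)/y=f(z)/z$, the elements $y,z$ are $\mathbb{F}_q$-linearly dependent. *)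

theory Defs
  imports
    "HOL-Library.Cardinality"
    "HOL-Computational_Algebra.Polynomial"
    "HOL-Number_Theory.Prime_Powers"
begin

text \<open>
  The field with \<open>q^(2*t)\<close> elements is any type \<open>'a :: {finite, field}\<close> with
  \<open>CARD('a) = q^(2*t)\<close>.  Its subfield of order \<open>r\<close> (where \<open>r = q\<close> or \<open>r = q^t\<close>) is the set of
  roots of \<open>X^r - X\<close>.
\<close>

definition subfield_of_order :: "nat \<Rightarrow> 'a::field set" where
  "subfield_of_order r = {x. x ^ r = x}"

definition rel_trace :: "nat \<Rightarrow> nat \<Rightarrow> 'a::field \<Rightarrow> 'a" where
  "rel_trace q t x = x + x ^ (q ^ t)"

definition rel_norm :: "nat \<Rightarrow> nat \<Rightarrow> 'a::field \<Rightarrow> 'a" where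
  "rel_norm q t x = x ^ (q ^ t + 1)"

text \<open>The element \<open>w = 0\<close> is not excluded, so \<open>0\<close> belongs to this set.\<close>

definition P_minus :: "nat \<Rightarrow> nat \<Rightarrow> nat \<Rightarrow> 'a::field set" where
  "P_minus q t s = {w ^ (q ^ s - 1) | w. rel_trace q t w = 0}"

text \<open>Linear dependence of the pair \<open>(y, z)\<close>; in particular \<open>(y, y)\<close> is dependent.\<close>

definition lin_dep_over :: "'a::field set \<Rightarrow> 'a \<Rightarrow> 'a \<Rightarrow> bool" where
  "lin_dep_over K y z \<longleftrightarrow>
     (\<exists>a\<in>K. \<exists>b\<in>K. (a \<noteq> 0 \<or> b \<noteq> 0) \<and> a * y + b * z = 0)"

text \<open>
  Meant for linearized polynomials (those whose monomials are all of the form \<open>X^(q^i)\<close>).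
  It depends only on the map induced by \<open>f\<close>, so \<open>f\<close> need not be reduced modulo
  \<open>X^(q^(2*t)) - X\<close>.
\<close>

definition scattered :: "nat \<Rightarrow> 'a::field poly \<Rightarrow> bool" where
  "scattered q f \<longleftrightarrow>
     (\<forall>y z. y \<noteq> 0 \<longrightarrow> z \<noteq> 0 \<longrightarrow> poly f y / y = poly f z / z \<longrightarrow>
        lin_dep_over (subfield_of_order q) y z)"

text \<open>The exponents of \<open>h\<close> are negative integers, hence \<open>powi\<close>.\<close>

definition psi :: "nat \<Rightarrow> nat \<Rightarrow> 'a::field \<Rightarrow> 'a \<Rightarrow> nat \<Rightarrow> 'a poly" where
  "psi q t m h s =
     smult m (monom 1 (q ^ s)
              - monom (h powi (1 - int q ^ (s * (t + 1)))) (q ^ (s * (t + 1))))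
     + monom 1 (q ^ (s * (t - 1)))
     + monom (h powi (1 - int q ^ (s * (2 * t - 1)))) (q ^ (s * (2 * t - 1)))"

end

theory Submission
  imports Defs
begin

text \<open>
  Write \<open>\<sigma>\<close> for the map \<open>x \<mapsto> x^(q^s)\<close> on the field with \<open>q^(2t)\<close> elements.  Since \<open>gcd s (2t) = 1\<close>,
  \<open>s\<close> is odd, so \<open>\<sigma>^t\<close> agrees with \<open>x \<mapsto> x^(q^t)\<close> on every element that the latter sends to a
  multiple \<open>\<plusminus>x\<close>.  Call \<open>x\<close> a \<open>\<delta>\<close>-eigenvector, \<open>\<delta> = \<plusminus>1\<close>, if \<open>x^(q^t) = \<delta> x\<close>.  The hypotheses on \<open>h\<close>
  say that \<open>h\<^sup>2 = \<plusminus>1\<close>, hence \<open>\<sigma> h = \<epsilon> h\<close> with a sign \<open>\<epsilon>\<close>, and both powers of \<open>h\<close> that occur as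
  coefficients are equal to \<open>\<epsilon>\<close>.  On a \<open>\<delta>\<close>-eigenvector the polynomial \<open>\<psi>\<close> therefore takes the value
  \<open>m (1 - \<epsilon>\<delta>) \<sigma> x + (1 + \<epsilon>\<delta>) \<sigma>^(t-1) x\<close> (lemma \<open>poly_psi_eigenvector\<close>): only one of the
  two halves survives.

  It remains to exhibit two \<open>F_q\<close>-independent eigenvectors \<open>y, z\<close> with \<open>\<psi> y / y = \<psi> z / z\<close>.  Let
  \<open>m = w^(q^s - 1)\<close> with \<open>w^(q^t) = -w\<close>.
  \<^item> If \<open>\<epsilon> = 1\<close> and \<open>w \<noteq> 0\<close>, then \<open>y = 1\<close> and \<open>z = 1/w\<close> have the common quotient \<open>2\<close>.
  \<^item> If \<open>\<epsilon> = -1\<close> and \<open>w \<noteq> 0\<close>, then \<open>y = 1\<close> and \<open>z = 1/(h \<sigma> w)\<close> have the common quotient \<open>2m\<close>.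
  \<^item> If \<open>w = 0\<close>, then \<open>m = 0\<close> and \<open>\<psi>\<close> vanishes on all \<open>(-\<epsilon>)\<close>-eigenvectors.  For \<open>\<epsilon> = -1\<close> these
    include \<open>1\<close> and \<open>h\<close>; for \<open>\<epsilon> = 1\<close> two independent ones are found by counting roots of
    \<open>X^n - 1\<close> (lemma \<open>ex_independent_anti_invariant\<close>).

  Independence is always seen from the quotient \<open>z/y\<close>, which would have to lie in \<open>F_q\<close> and so be
  fixed by every power of \<open>x \<mapsto> x^q\<close>.
\<close>

section \<open>Iterated powers\<close>

lemma power_iterate_eigen:
  fixes x d :: "'a::comm_monoid_mult"
  assumes "x ^ k = d * x" and "d ^ k = d"
  shows "x ^ (k ^ n) = d ^ n * x"
proof (induction n)
  case (Suc n)
  have "x ^ (k ^ Suc n) = (x ^ (k ^ n)) ^ k"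
    by (simp add: power_mult[symmetric] mult.commute)
  also have "\<dots> = (d ^ k) ^ n * x ^ k"
    by (simp add: Suc power_mult_distrib power_mult[symmetric] mult.commute)
  also have "\<dots> = d ^ Suc n * x"
    using assms by (simp add: mult_ac)
  finally show ?case .
qed simp

lemma power_fixed_iterate:
  fixes x :: "'a::comm_monoid_mult"
  assumes "x ^ k = x"
  shows "x ^ (k ^ n) = x"
  using power_iterate_eigen[of x k 1 n] assms by simp

lemma sign_power_odd:
  fixes d :: "'a::comm_ring_1"
  assumes "d = 1 \<or> d = - 1" and "odd n"
  shows "d ^ n = d"
  using assms by auto

section \<open>Counting in finite fields\<close>

lemma finite_field_power_card_minus_one:
  fixes x :: "'a::{finite,field}"
  assumes "x \<noteq> 0"
  shows "x ^ (CARD('a) - 1) = 1"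
proof -
  \<comment> \<open>Multiplication by \<open>x\<close> permutes the nonzero elements, so it does not change their product.\<close>
  have "(\<Prod>y\<in>UNIV-{0}. y) = (\<Prod>y\<in>UNIV-{0}. x * y)"
    by (rule prod.reindex_bij_witness[of _ "\<lambda>y. x * y" "\<lambda>y. y / x"]) (use assms in auto)
  also have "\<dots> = x ^ (CARD('a) - 1) * (\<Prod>y\<in>UNIV-{0}. y)"
    by (simp add: prod.distrib)
  finally show ?thesis
    by simp
qed

lemma ex_power_neq_one:
  assumes "0 < n" and "n < CARD('a::{finite,field}) - 1"
  shows "\<exists>u::'a. u \<noteq> 0 \<and> u ^ n \<noteq> 1"
proof (rule ccontr)
  let ?p = "monom 1 n - 1 :: 'a poly"
  assume "\<not> ?thesis"
  then have sub: "UNIV - {0} \<subseteq> {u. poly ?p u = 0}"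
    by (auto simp: poly_monom)
  have "coeff ?p n = 1"
    using assms by simp
  then have "?p \<noteq> 0"
    by force
  have "CARD('a) - 1 = card (UNIV - {0::'a})"
    by simp
  also have "\<dots> \<le> card {u. poly ?p u = 0}"
    by (rule card_mono[OF _ sub]) simp
  also have "\<dots> \<le> degree ?p"
    by (rule card_poly_roots_bound[OF \<open>?p \<noteq> 0\<close>])
  also have "\<dots> \<le> n"
    by (rule degree_diff_le) (auto simp: degree_monom_le)
  finally show False
    using assms by simp
qed

text \<open>
  If \<open>1 = -1\<close>, then \<open>1\<close> is the only square root of \<open>1\<close>, so \<open>u^((N-1)/2) = 1\<close> for all \<open>u \<noteq> 0\<close>, where
  \<open>N\<close> is the number of elements: too many roots.
\<close>

lemma two_neq_zero_odd_card:
  assumes "odd (CARD('a::{finite,field}))"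
  shows "(2::'a) \<noteq> 0"
proof
  assume "(2::'a) = 0"
  then have char: "- 1 = (1::'a)"
    by (simp add: neg_eq_iff_add_eq_0)
  obtain n where n: "CARD('a) = 2 * n + 1"
    using assms by (rule oddE)
  have "card {0, 1::'a} \<le> CARD('a)"
    by (rule card_mono) auto
  then have "0 < n"
    using n by simp
  then obtain u :: 'a where u: "u \<noteq> 0" "u ^ n \<noteq> 1"
    using ex_power_neq_one[of n, where ?'a = 'a] n by auto
  have "(u ^ n)\<^sup>2 = 1"
    using finite_field_power_card_minus_one[OF u(1)] n
    by (simp add: power_mult[symmetric] mult.commute)
  then show False
    using u(2) char by (simp add: power2_eq_1_iff)
qed

text \<open>
  A nonsquare \<open>u\<close> satisfies \<open>u^((q^(2t)-1)/2) = -1\<close>, so \<open>x = u^((q^t+1)/2)\<close> has \<open>x^(q^t-1) = -1\<close>.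
  Multiplying \<open>x\<close> by a norm \<open>v^(q^t+1)\<close> preserves this property, and not all norms lie in
  \<open>F_q\<close>, because \<open>X^((q^t+1)(q-1)) - 1\<close> has too few roots.
\<close>

lemma ex_independent_anti_invariant:
  fixes q t :: nat
  assumes card: "CARD('a::{finite,field}) = q ^ (2 * t)" and q: "odd q" "q > 1" and t: "t \<ge> 2"
  shows "\<exists>y z::'a. y \<noteq> 0 \<and> z \<noteq> 0 \<and> y ^ (q ^ t) = - y \<and> z ^ (q ^ t) = - z \<and> (z / y) ^ q \<noteq> z / y"
proof -
  define Q where "Q = q ^ t"
  have "q ^ 2 \<le> Q"
    unfolding Q_def using q t by (intro power_increasing) auto
  then have qQ: "q < Q"
    using q by (metis less_le_trans less_trans power2_eq_square n_less_m_mult_n One_nat_def zero_less_one)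
  have "odd Q"
    using q by (simp add: Q_def)
  then obtain k where k: "Q = 2 * k + 1"
    by (rule oddE)
  have "k > 0"
    using qQ q k by simp
  have "q ^ (2 * t) = Q * Q"
    by (simp add: Q_def mult_2 power_add)
  then have card1: "CARD('a) - 1 = (Q + 1) * (2 * k)"
    unfolding card by (simp add: k algebra_simps)
  have "(k + 1) * (2 * k) < CARD('a) - 1"
    unfolding card1 using \<open>k > 0\<close> k by simp
  then obtain u :: 'a where u: "u \<noteq> 0" "u ^ ((k + 1) * (2 * k)) \<noteq> 1"
    using ex_power_neq_one[of "(k + 1) * (2 * k)", where ?'a = 'a] \<open>k > 0\<close> by auto
  have "q - 1 < 2 * k"
    using qQ q k by simp
  then have "(Q + 1) * (q - 1) < CARD('a) - 1"
    unfolding card1 by (intro mult_strict_left_mono) auto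
  then obtain v :: 'a where v: "v \<noteq> 0" "v ^ ((Q + 1) * (q - 1)) \<noteq> 1"
    using ex_power_neq_one[of "(Q + 1) * (q - 1)", where ?'a = 'a] q by auto
  define x where "x = u ^ (k + 1)"
  define c where "c = v ^ (Q + 1)"
  have nz: "x \<noteq> 0" "c \<noteq> 0"
    using u v by (auto simp: x_def c_def)
  have "(x ^ (2 * k))\<^sup>2 = u ^ (CARD('a) - 1)"
    unfolding x_def card1 k by (simp add: power_mult[symmetric] power_add[symmetric] algebra_simps)
  then have "(x ^ (2 * k))\<^sup>2 = 1"
    using finite_field_power_card_minus_one[OF u(1)] by simp
  moreover have "x ^ (2 * k) \<noteq> 1"
    using u(2) by (simp only: x_def power_mult[of u "k + 1" "2 * k"] not_False_eq_True)
  ultimately have "x ^ (2 * k) = - 1"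
    by (simp add: power2_eq_1_iff)
  then have x: "x ^ Q = - x"
    unfolding k by simp
  have "c ^ (2 * k) = v ^ (CARD('a) - 1)"
    unfolding c_def card1 by (rule power_mult[symmetric])
  then have "c ^ Q = c"
    unfolding k using finite_field_power_card_minus_one[OF v(1)] by simp
  then have xc: "(x * c) ^ Q = - (x * c)"
    using x by (simp add: power_mult_distrib)
  have "c ^ q \<noteq> c"
  proof
    assume "c ^ q = c"
    moreover have "c ^ q = c * c ^ (q - 1)"
      using q power_minus_mult[of q c] by (simp add: mult.commute)
    ultimately have "c ^ (q - 1) = 1"
      using nz by simp
    then show False
      using v(2) unfolding c_def by (simp only: power_mult[symmetric] simp_thms)
  qed
  then have "(x * c / x) ^ q \<noteq> x * c / x"
    using nz by simp
  with x xc nz show ?thesis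
    unfolding Q_def by (intro exI[of _ x] exI[of _ "x * c"]) auto
qed

section \<open>A criterion for not being scattered\<close>

lemma lin_dep_over_subfield_quotient:
  fixes y z :: "'a::field"
  assumes "lin_dep_over (subfield_of_order q) y z" and "y \<noteq> 0" "z \<noteq> 0" and "odd q"
  shows "(z / y) ^ q = z / y"
proof -
  obtain a b where ab: "a ^ q = a" "b ^ q = b" "a \<noteq> 0 \<or> b \<noteq> 0" "a * y + b * z = 0"
    using assms(1) by (auto simp: lin_dep_over_def subfield_of_order_def)
  have "b \<noteq> 0"
    using ab assms by auto
  have "z * b = - (a * y)"
    using ab(4) by (simp add: eq_neg_iff_add_eq_0 algebra_simps)
  then have "z / y = - (a / b)"
    using \<open>b \<noteq> 0\<close> assms by (simp add: field_simps)
  moreover have "(- (a / b)) ^ q = - (a / b)"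
    using ab \<open>odd q\<close> by (simp add: power_divide)
  ultimately show ?thesis
    by simp
qed

lemma not_scatteredI:
  assumes "odd q" and "y \<noteq> 0" "z \<noteq> 0" and "(z / y) ^ q \<noteq> z / y"
    and "poly f y = l * y" and "poly f z = l * z"
  shows "\<not> scattered q f"
proof
  assume "scattered q f"
  then have "lin_dep_over (subfield_of_order q) y z"
    unfolding scattered_def using assms by auto
  from lin_dep_over_subfield_quotient[OF this] show False
    using assms by blast
qed

lemma anti_invariant_power_neq:
  fixes x :: "'a::field"
  assumes "x ^ (q ^ n) = - x" and "x \<noteq> 0" and "(2::'a) \<noteq> 0"
  shows "x ^ q \<noteq> x"
proof
  assume "x ^ q = x"
  then have "x = - x"
    using power_fixed_iterate[of x q n] assms(1) by simp
  then have "2 * x = 0"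
    by (simp add: eq_neg_iff_add_eq_0)
  with assms show False
    by simp
qed

section \<open>The values of \<open>\<psi>\<close> on eigenvectors\<close>

text \<open>
  Because \<open>n - 1\<close> is even, \<open>h^(n-1)\<close> squares to \<open>(\<plusminus>1)^(n-1) = 1\<close>, so it is a sign.
\<close>

lemma sign_eigenvalue:
  fixes h :: "'a::field"
  assumes "h\<^sup>2 = 1 \<or> h\<^sup>2 = - 1" and "odd n"
  obtains e where "e = 1 \<or> e = - 1" and "h ^ n = e * h"
proof -
  have "(h ^ (n - 1))\<^sup>2 = (h\<^sup>2) ^ (n - 1)"
    by (simp add: power_mult[symmetric] mult.commute)
  also have "\<dots> = 1"
    using assms by auto
  finally have "h ^ (n - 1) = 1 \<or> h ^ (n - 1) = - 1"
    by (simp add: power2_eq_1_iff)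
  moreover have "h ^ n = h ^ (n - 1) * h"
    by (rule power_minus_mult[OF odd_pos[OF assms(2)], symmetric])
  ultimately show ?thesis
    using that by blast
qed

lemma poly_psi:
  "poly (psi q t m h s) x =
     m * (x ^ (q ^ s) - h powi (1 - int q ^ (s * (t + 1))) * x ^ (q ^ (s * (t + 1))))
     + x ^ (q ^ (s * (t - 1))) + h powi (1 - int q ^ (s * (2 * t - 1))) * x ^ (q ^ (s * (2 * t - 1)))"
  by (simp add: psi_def poly_monom)

text \<open>
  The exponents \<open>s(t+1)\<close> and \<open>s(2t-1)\<close> exceed \<open>s\<close> and \<open>s(t-1)\<close> by \<open>st\<close>, and raising an eigenvector to
  the power \<open>q^(st)\<close> multiplies it by \<open>\<delta>^s = \<delta>\<close>.
\<close>

lemma eigenvector_high_powers: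
  fixes x d :: "'a::field"
  assumes x: "x ^ (q ^ t) = d * x" and d: "d = 1 \<or> d = - 1"
    and "odd q" and "odd s" and "t \<ge> 1"
  shows "x ^ (q ^ (s * t)) = d * x"
    and "x ^ (q ^ (s * (t + 1))) = d * x ^ (q ^ s)"
    and "x ^ (q ^ (s * (2 * t - 1))) = d * x ^ (q ^ (s * (t - 1)))"
proof -
  have odd_power: "d ^ (q ^ n) = d" for n
    using d \<open>odd q\<close> by (intro sign_power_odd) auto
  have "x ^ ((q ^ t) ^ s) = d ^ s * x"
    by (rule power_iterate_eigen[OF x odd_power])
  then show st: "x ^ (q ^ (s * t)) = d * x"
    using sign_power_odd[OF d \<open>odd s\<close>] by (simp add: power_mult[symmetric] mult.commute)
  have shift: "x ^ (q ^ (s * t + n)) = d * x ^ (q ^ n)" for n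
    by (simp only: power_add power_mult[of x] st power_mult_distrib odd_power)
  show "x ^ (q ^ (s * (t + 1))) = d * x ^ (q ^ s)"
    using shift[of s] by (simp add: algebra_simps)
  have "s * (2 * t - 1) = s * t + s * (t - 1)"
    using \<open>t \<ge> 1\<close> by (simp add: algebra_simps diff_mult_distrib2)
  then show "x ^ (q ^ (s * (2 * t - 1))) = d * x ^ (q ^ (s * (t - 1)))"
    using shift[of "s * (t - 1)"] by simp
qed

lemma power_int_one_minus:
  fixes h :: "'a::field"
  assumes "h \<noteq> 0" and "h ^ (q ^ k) = e * h" and "e = 1 \<or> e = - 1"
  shows "h powi (1 - int q ^ k) = e"
proof -
  have "h powi (1 - int (q ^ k)) = h powi 1 / h powi int (q ^ k)"
    using \<open>h \<noteq> 0\<close> by (intro power_int_diff) simp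
  also have "\<dots> = h / h ^ (q ^ k)"
    by (simp only: power_int_of_nat power_int_1_right)
  also have "\<dots> = e"
    using assms by auto
  finally show ?thesis
    by simp
qed

lemma poly_psi_eigenvector:
  fixes h x d e :: "'a::field"
  assumes q: "odd q" and s: "odd s" and t: "t \<ge> 1" and "h \<noteq> 0"
    and h: "h ^ (q ^ t) = h" "h ^ (q ^ s) = e * h" and e: "e = 1 \<or> e = - 1"
    and x: "x ^ (q ^ t) = d * x" and d: "d = 1 \<or> d = - 1"
  shows "poly (psi q t m h s) x =
           m * (1 - e * d) * x ^ (q ^ s) + (1 + e * d) * x ^ (q ^ (s * (t - 1)))"
proof -
  have h': "h ^ (q ^ t) = 1 * h"
    using h by simp
  note hp = eigenvector_high_powers[OF h' _ q s t]
  have odd_power: "e ^ (q ^ s) = e"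
    using e q by (intro sign_power_odd) auto
  have iter: "h ^ (q ^ (s * n)) = e ^ n * h" for n
    using power_iterate_eigen[OF h(2) odd_power] by (simp add: power_mult)
  have "h ^ (q ^ (s * (t + 1))) = e * h"
    using hp h by simp
  then have c1: "h powi (1 - int q ^ (s * (t + 1))) = e"
    by (rule power_int_one_minus[OF \<open>h \<noteq> 0\<close> _ e])
  have "h ^ (q ^ (s * (2 * t - 1))) = e * h"
    unfolding iter using e t by (simp add: sign_power_odd)
  then have c2: "h powi (1 - int q ^ (s * (2 * t - 1))) = e"
    by (rule power_int_one_minus[OF \<open>h \<noteq> 0\<close> _ e])
  show ?thesis
    unfolding poly_psi c1 c2 eigenvector_high_powers[OF x d q s t] by (simp add: algebra_simps)
qed

section \<open>Two independent elements with the same quotient\<close>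

theorem theorem6p1:
  fixes q t s :: nat and m h :: "'a::{finite,field}"
  assumes "primepow q" and "odd q"
    and "t \<ge> 3"
    and "1 \<le> s" and "s \<le> 2 * t - 1" and "gcd s (2 * t) = 1"
    and "CARD('a) = q ^ (2 * t)"
    and "m \<in> P_minus q t s"
    and "h \<in> subfield_of_order (q ^ t)"
    and "rel_norm q t h = 1 \<or> rel_norm q t h = - 1"
  shows "\<not> scattered q (psi q t m h s)"
proof -
  have q1: "q > 1"
    using primepow_gt_Suc_0[OF assms(1)] by simp
  have s: "odd s"
    using assms(6) by (metis dvd_triv_left gcd_greatest odd_one)
  have t: "t \<ge> 1"
    using assms(3) by simp
  have two: "(2::'a) \<noteq> 0"
    using assms(2,7) by (intro two_neq_zero_odd_card) simp
  obtain w where w: "w ^ (q ^ t) = - w" and m: "m = w ^ (q ^ s - 1)"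
    using assms(8) by (auto simp: P_minus_def rel_trace_def add_eq_0_iff)
  have h: "h ^ (q ^ t) = h"
    using assms(9) by (simp add: subfield_of_order_def)
  then have h2: "h\<^sup>2 = 1 \<or> h\<^sup>2 = - 1"
    using assms(10) by (simp add: rel_norm_def power2_eq_square)
  then have "h \<noteq> 0"
    by auto
  have "odd (q ^ s)"
    using assms(2) by simp
  obtain e where e: "e = 1 \<or> e = - 1" and he: "h ^ (q ^ s) = e * h"
    by (rule sign_eigenvalue[OF h2 \<open>odd (q ^ s)\<close>])
  note psi_value = poly_psi_eigenvector[OF assms(2) s t \<open>h \<noteq> 0\<close> h he e]
  have invariant: "poly (psi q t m h s) x =
      m * (1 - e) * x ^ (q ^ s) + (1 + e) * x ^ (q ^ (s * (t - 1)))"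
    if "x ^ (q ^ t) = x" for x
    using psi_value[of x 1] that by simp
  have anti_invariant: "poly (psi q t m h s) x =
      m * (1 + e) * x ^ (q ^ s) + (1 - e) * x ^ (q ^ (s * (t - 1)))"
    if "x ^ (q ^ t) = - x" for x
    using psi_value[of x "- 1"] that by simp
  note independent = anti_invariant_power_neq[OF _ _ two]
  have mw: "m * w = w ^ (q ^ s)"
    unfolding m using q1 by (intro power_minus_mult) simp
  have "q ^ s > 1"
    using q1 assms(4) by (intro one_less_power) auto
  consider (plus) "e = 1" "w \<noteq> 0" | (minus) "e = - 1" "w \<noteq> 0"
    | (zero_plus) "e = 1" "w = 0" | (zero_minus) "e = - 1" "w = 0"
    using e by blast
  then show ?thesis
  proof cases
    case plus
    let ?z = "1 / w"
    have z: "?z ^ (q ^ t) = - ?z"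
      using w by (simp add: power_divide)
    have "m * ?z ^ (q ^ s) = ?z"
      using mw plus by (simp add: power_divide field_simps)
    then have "poly (psi q t m h s) ?z = 2 * ?z"
      using anti_invariant[OF z] plus by (simp add: mult.assoc mult.left_commute[of m])
    moreover have "poly (psi q t m h s) 1 = 2 * 1"
      using invariant[of 1] plus by simp
    moreover have "(?z / 1) ^ q \<noteq> ?z / 1"
      using independent[OF z] plus by simp
    ultimately show ?thesis
      using plus by (intro not_scatteredI[OF assms(2), of 1 ?z]) auto
  next
    case minus
    let ?z = "1 / (h * w ^ (q ^ s))"
    have "(w ^ (q ^ s)) ^ (q ^ t) = (w ^ (q ^ t)) ^ (q ^ s)"
      by (simp add: power_mult[symmetric] mult.commute)
    also have "\<dots> = - (w ^ (q ^ s))"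
      unfolding w using assms(2) by simp
    finally have z: "?z ^ (q ^ t) = - ?z"
      using h by (simp add: power_divide power_mult_distrib)
    \<comment> \<open>\<open>z\<close> has the denominator \<open>h \<sigma> w\<close>, equal to \<open>-\<sigma>(h w)\<close>, so \<open>\<sigma>^(t-1)\<close> can be evaluated on it
      by means of \<open>\<sigma>^t\<close>, which fixes \<open>h\<close> and negates \<open>w\<close>.\<close>
    have st: "s + s * (t - 1) = s * t"
      using t by (cases t) auto
    have w': "w ^ (q ^ t) = (- 1) * w" and h': "h ^ (q ^ t) = 1 * h"
      using w h by simp_all
    have "(w ^ (q ^ s)) ^ (q ^ (s * (t - 1))) = w ^ (q ^ (s * t))"
      by (simp only: power_mult[symmetric] power_add[symmetric] st)
    also have "\<dots> = - w"
      using eigenvector_high_powers(1)[OF w' _ assms(2) s t] by simp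
    finally have w_pow: "(w ^ (q ^ s)) ^ (q ^ (s * (t - 1))) = - w" .
    have "(h ^ (q ^ s)) ^ (q ^ (s * (t - 1))) = h ^ (q ^ (s * t))"
      by (simp only: power_mult[symmetric] power_add[symmetric] st)
    also have "\<dots> = h"
      using eigenvector_high_powers(1)[OF h' _ assms(2) s t] by simp
    finally have "(- h) ^ (q ^ (s * (t - 1))) = h"
      using he minus by simp
    then have h_pow: "h ^ (q ^ (s * (t - 1))) = - h"
      using assms(2) by (metis even_power minus_minus power_minus_odd)
    have "?z ^ (q ^ (s * (t - 1))) = 1 / (h * w)"
      by (simp add: power_divide power_mult_distrib w_pow h_pow del: One_nat_def)
    also have "\<dots> = m * ?z"
      using mw[symmetric] minus \<open>h \<noteq> 0\<close> by (simp add: m field_simps)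
    finally have "poly (psi q t m h s) ?z = 2 * m * ?z"
      using anti_invariant[OF z] minus by simp
    moreover have "poly (psi q t m h s) 1 = 2 * m * 1"
      using invariant[of 1] minus by simp
    moreover have "(?z / 1) ^ q \<noteq> ?z / 1"
      using independent[OF z] minus \<open>h \<noteq> 0\<close> by simp
    ultimately show ?thesis
      using minus \<open>h \<noteq> 0\<close> by (intro not_scatteredI[OF assms(2), of 1 ?z]) auto
  next
    case zero_plus
    then have "m = 0"
      using m \<open>q ^ s > 1\<close> by simp
    obtain y z :: 'a where yz: "y \<noteq> 0" "z \<noteq> 0" "y ^ (q ^ t) = - y" "z ^ (q ^ t) = - z"
        "(z / y) ^ q \<noteq> z / y"
      using ex_independent_anti_invariant[OF assms(7,2) q1] assms(3) by auto
    show ?thesis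
      using yz zero_plus \<open>m = 0\<close> anti_invariant
      by (intro not_scatteredI[OF assms(2), of y z _ 0]) auto
  next
    case zero_minus
    then have "m = 0"
      using m \<open>q ^ s > 1\<close> by simp
    have "h ^ q \<noteq> h"
      using he zero_minus \<open>h \<noteq> 0\<close> by (intro independent) auto
    then show ?thesis
      using zero_minus \<open>m = 0\<close> \<open>h \<noteq> 0\<close> invariant h
      by (intro not_scatteredI[OF assms(2), of 1 h _ 0]) auto
  qed
qed

end
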